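(* Let $(F,W,P,\boldsymbol{q})$ be a many-to-one matching market (with strict preferences, and $\boldsymbol{q}$-responsive preferences for firms). Let $\bar{x}$ be a strongly stable fractional matching. Then there are stable matchings $\mu^1,\ldots,\mu^k$ and real numbers $\alpha_1,\ldots,\alpha_k$ such that $$\bar{x}=\sum_{l=1}^{k}\alpha_l x^{\mu^l},\qquad 0<\alpha_l\le 1,\qquad \sum_{l=1}^k\alpha_l=1,\qquad \mu^1\succ_F\mu^2\succ_F\cdots\succ_F\mu^k .$$
   Context: MARKET. $F$ (firms) and $W$ (workers) are finite disjoint sets. Each worker $w$ has a strict linear order $\succ_w$ on $F\cup\{w\}$ ($w$ stands for being unmatched). Each firm $f$ has a quota $q_f$ (a positive integer) and a strict linear order $\succ_f$ on $2^W$; $\boldsymbol q=(q_f)_{f\in F}$; $P$ is the profile of all these preferences. $\succeq$ denotes "$\succ$ or equal". For workers $j,w$ write $j\succ_f w$ for $\{j\}\succ_f\{w\}$. Firms' preferences are $\boldsymbol q$-responsive: (1) $\emptyset\succ_f T$ whenever $|T|>q_f$; (2) if $|T|<q_f$ and $w\notin T$, then $T\cup\{w\}\succ_f T$ iff $\{w\}\succ_f\emptyset$; (3) if $|T|<q_f$ and $w,w'\notin T$, then $T\cup\{w\}\succ_f T\cup\{w'\}$ iff $w\succ_f w'$. A pair $(f,w)$ is acceptable if $\{w\}\succ_f\emptyset$ and $f\succ_w w$; $A=A(P)$ is the set of acceptable pairs. MATCHINGS. A matching $\mu$ assigns to each worker $w$ either one firm or $w$ itself (unmatched), and to each firm $f$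 a set $\mu(f)\subseteq W$ with $|\mu(f)|\le q_f$, so that $\mu(w)=f$ iff $w\in\mu(f)$. $\mu$ is individually rational if every matched pair is acceptable. A pair $(f,w)$ with $\mu(w)\ne f$ blocks $\mu$ if $f\succ_w\mu(w)$ and either $|\mu(f)|=q_f$ and $w\succ_f w'$ for some $w'\in\mu(f)$, or $|\mu(f)|<q_f$ and $\{w\}\succ_f\emptyset$. $\mu$ is stable if it is individually rational and has no blocking pair. The incidence vector $x^\mu\in\{0,1\}^{F\times W}$ has $x^\mu_{f,w}=1$ iff $\mu(w)=f$. $\mu\succ_F\mu'$ means $\mu(f)\succeq_f\mu'(f)$ for all $f\in F$ and $\mu(f')\succ_{f'}\mu'(f')$ for at least one $f'\in F$. STRONG STABILITY. The polytope $CP$ is the set of $x\in\mathbb{R}^{F\times W}$ with $\sum_{j\in W}x_{f,j}\le q_f$ for all $f$; $\sum_{i\in F}x_{i,w}\le 1$ for all $w$; $x_{f,w}\ge0$ for all $(f,w)$; $x_{f,w}=0$ for $(f,w)\notin A$. A strongly stable fractional matching is a (not necessarily integer) point $\bar x\in CP$ such that for every $(f,w)\in A$, $$\Bigl[q_f-\sum_{j\succeq_f w}\bar x_{f,j}\Bigr]\cdot\Bigl[1-\sum_{i\succeq_w f}\bar x_{i,w}\Bigr]=0,$$ where the first sum is over workers $j$ with $j\succeq_f w$ and the second over firms $i$ with $i\succeq_w f$. *)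

theory Defs
  imports "HOL-Analysis.Analysis"
begin

definition strict_linear_orderp_on :: "'a set \<Rightarrow> ('a \<Rightarrow> 'a \<Rightarrow> bool) \<Rightarrow> bool" where
  "strict_linear_orderp_on X R \<longleftrightarrow> irreflp_on X R \<and> transp_on X R \<and> totalp_on X R"

(* Firms and workers live in different types, which makes them disjoint.
   wpref M w a b means that worker w strictly prefers a to b, where Some f is the firm f and
   None stands for w itself (being unmatched).  fpref M f S T means that firm f strictly
   prefers S to T.  Values of the fields outside the carriers are irrelevant. *)
record ('f, 'w) market =
  firms :: "'f set"
  workers :: "'w set"
  quota :: "'f \<Rightarrow> nat"
  fpref :: "'f \<Rightarrow> 'w set \<Rightarrow> 'w set \<Rightarrow> bool"
  wpref :: "'w \<Rightarrow> 'f option \<Rightarrow> 'f option \<Rightarrow> bool"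

definition responsive :: "'w set \<Rightarrow> nat \<Rightarrow> ('w set \<Rightarrow> 'w set \<Rightarrow> bool) \<Rightarrow> bool" where
  "responsive W q R \<longleftrightarrow>
     (\<forall>T. T \<subseteq> W \<and> card T > q \<longrightarrow> R {} T) \<and>
     (\<forall>T w. T \<subseteq> W \<and> card T < q \<and> w \<in> W - T \<longrightarrow> (R (T \<union> {w}) T \<longleftrightarrow> R {w} {})) \<and>
     (\<forall>T w w'. T \<subseteq> W \<and> card T < q \<and> w \<in> W - T \<and> w' \<in> W - T \<longrightarrow>
        (R (T \<union> {w}) (T \<union> {w'}) \<longleftrightarrow> R {w} {w'}))"

definition responsive_market :: "('f, 'w) market \<Rightarrow> bool" where
  "responsive_market M \<longleftrightarrow>
     finite (firms M) \<and> finite (workers M) \<and>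
     (\<forall>w\<in>workers M. strict_linear_orderp_on (insert None (Some ` firms M)) (wpref M w)) \<and>
     (\<forall>f\<in>firms M. quota M f > 0 \<and>
        strict_linear_orderp_on (Pow (workers M)) (fpref M f) \<and>
        responsive (workers M) (quota M f) (fpref M f))"

definition acceptable :: "('f, 'w) market \<Rightarrow> ('f \<times> 'w) set" where
  "acceptable M =
     {(f, w). f \<in> firms M \<and> w \<in> workers M \<and> fpref M f {w} {} \<and> wpref M w (Some f) None}"

(* A matching is represented by its worker side; the firm side is determined by the
   requirement that w is in mu(f) iff mu(w) = f. *)
definition assigned :: "('f, 'w) market \<Rightarrow> ('w \<Rightarrow> 'f option) \<Rightarrow> 'f \<Rightarrow> 'w set" where
  "assigned M \<mu> f = {w \<in> workers M. \<mu> w = Some f}"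

definition matching :: "('f, 'w) market \<Rightarrow> ('w \<Rightarrow> 'f option) \<Rightarrow> bool" where
  "matching M \<mu> \<longleftrightarrow>
     (\<forall>w\<in>workers M. \<mu> w \<in> insert None (Some ` firms M)) \<and>
     (\<forall>f\<in>firms M. card (assigned M \<mu> f) \<le> quota M f)"

definition individually_rational :: "('f, 'w) market \<Rightarrow> ('w \<Rightarrow> 'f option) \<Rightarrow> bool" where
  "individually_rational M \<mu> \<longleftrightarrow>
     (\<forall>f\<in>firms M. \<forall>w\<in>workers M. \<mu> w = Some f \<longrightarrow> (f, w) \<in> acceptable M)"

definition blocks :: "('f, 'w) market \<Rightarrow> 'f \<Rightarrow> 'w \<Rightarrow> ('w \<Rightarrow> 'f option) \<Rightarrow> bool" where
  "blocks M f w \<mu> \<longleftrightarrow>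
     \<mu> w \<noteq> Some f \<and> wpref M w (Some f) (\<mu> w) \<and>
     (card (assigned M \<mu> f) = quota M f \<and> (\<exists>w'\<in>assigned M \<mu> f. fpref M f {w} {w'}) \<or>
      card (assigned M \<mu> f) < quota M f \<and> fpref M f {w} {})"

definition stable_matching :: "('f, 'w) market \<Rightarrow> ('w \<Rightarrow> 'f option) \<Rightarrow> bool" where
  "stable_matching M \<mu> \<longleftrightarrow>
     matching M \<mu> \<and> individually_rational M \<mu> \<and>
     \<not> (\<exists>f\<in>firms M. \<exists>w\<in>workers M. blocks M f w \<mu>)"

definition incidence :: "('w \<Rightarrow> 'f option) \<Rightarrow> 'f \<Rightarrow> 'w \<Rightarrow> real" where
  "incidence \<mu> f w = (if \<mu> w = Some f then 1 else 0)"

definition firms_prefer ::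
  "('f, 'w) market \<Rightarrow> ('w \<Rightarrow> 'f option) \<Rightarrow> ('w \<Rightarrow> 'f option) \<Rightarrow> bool" where
  "firms_prefer M \<mu> \<mu>' \<longleftrightarrow>
     (\<forall>f\<in>firms M. (fpref M f)\<^sup>=\<^sup>= (assigned M \<mu> f) (assigned M \<mu>' f)) \<and>
     (\<exists>f\<in>firms M. fpref M f (assigned M \<mu> f) (assigned M \<mu>' f))"

(* Vectors indexed by F x W are curried functions; only their values on F x W matter. *)
definition CP :: "('f, 'w) market \<Rightarrow> ('f \<Rightarrow> 'w \<Rightarrow> real) set" where
  "CP M = {x.
     (\<forall>f\<in>firms M. (\<Sum>j\<in>workers M. x f j) \<le> real (quota M f)) \<and>
     (\<forall>w\<in>workers M. (\<Sum>i\<in>firms M. x i w) \<le> 1) \<and>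
     (\<forall>f\<in>firms M. \<forall>w\<in>workers M. x f w \<ge> 0) \<and>
     (\<forall>f\<in>firms M. \<forall>w\<in>workers M. (f, w) \<notin> acceptable M \<longrightarrow> x f w = 0)}"

definition strongly_stable_fractional :: "('f, 'w) market \<Rightarrow> ('f \<Rightarrow> 'w \<Rightarrow> real) \<Rightarrow> bool" where
  "strongly_stable_fractional M x \<longleftrightarrow>
     x \<in> CP M \<and>
     (\<forall>(f, w)\<in>acceptable M.
        (real (quota M f) - (\<Sum>j | j \<in> workers M \<and> (fpref M f)\<^sup>=\<^sup>= {j} {w}. x f j)) *
        (1 - (\<Sum>i | i \<in> firms M \<and> (wpref M w)\<^sup>=\<^sup>= (Some i) (Some f). x i w)) = 0)"

end

theory Submission
  imports Defs
begin

text \<open>Call a pair with \<open>0 < x f w < 1\<close> fractional. Strong stability says that every fractional pair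
  \<open>(f, w)\<close> lies in \<open>firm_last\<close> (\<open>f\<close> is full and \<open>w\<close> is the worst worker that \<open>f\<close> uses) or in
  \<open>worker_last\<close> (\<open>w\<close> is full and \<open>f\<close> is the worst firm that \<open>w\<close> uses). By integrality of the
  quotas, every firm with a fractional pair has one outside \<open>firm_last\<close>, and every such worker has
  one outside \<open>worker_last\<close>. Counting then forces the two sets to be disjoint perfect matchings
  between the fractional firms and the fractional workers. So each fractional firm \<open>f\<close> has exactly
  two fractional workers, \<open>b\<close> with \<open>(f, b)\<close> in \<open>worker_last\<close> and a less preferred \<open>c\<close> with
  \<open>(f, c)\<close> in \<open>firm_last\<close>, and \<open>x f b + x f c = 1\<close>; dually for workers. For a threshold
  \<open>t \<in> (0, 1]\<close> let \<open>\<mu> t\<close> consist of the pairs with \<open>x f w = 1\<close>, those in \<open>worker_last\<close> with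
  \<open>t \<le> x f w\<close>, and those in \<open>firm_last\<close> with \<open>t > 1 - x f w\<close>. Each \<open>\<mu> t\<close> is stable, it gets worse
  for the firms as \<open>t\<close> grows, and \<open>x\<close> is the integral of its incidence vector over \<open>t\<close>.\<close>

section \<open>Upper contour sets of a linear order and sums over them\<close>

definition upper :: "'a set \<Rightarrow> ('a \<Rightarrow> 'a \<Rightarrow> bool) \<Rightarrow> 'a \<Rightarrow> 'a set" where
  "upper X R a = {j \<in> X. R j a \<or> j = a}"

text \<open>The bound \<open>n\<close> is already used up on the upper set, so the nonnegative
  entries outside it vanish. This turns a zero factor in strong stability into fullness of the agent
  plus a restriction of its support.\<close>

lemma upper_sum_full:
  fixes y :: "'a \<Rightarrow> real"
  assumes "finite X" "\<forall>j\<in>X. 0 \<le> y j" "sum y X \<le> n" "sum y (upper X R a) = n"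
  shows "sum y X = n"
    and "\<And>j. j \<in> X \<Longrightarrow> 0 < y j \<Longrightarrow> j \<in> upper X R a"
proof -
  have sub: "upper X R a \<subseteq> X" by (auto simp: upper_def)
  have split: "sum y X = sum y (upper X R a) + sum y (X - upper X R a)"
    using sum.subset_diff[OF sub \<open>finite X\<close>, of y] by simp
  have "sum y (X - upper X R a) \<ge> 0" using assms(2) by (intro sum_nonneg) auto
  with split assms have zero: "sum y (X - upper X R a) = 0" by simp
  then show "sum y X = n" using split assms by simp
  have "\<forall>j\<in>X - upper X R a. y j = 0"
    using zero assms sum_nonneg_eq_0_iff[of "X - upper X R a" y] by auto
  then show "\<And>j. j \<in> X \<Longrightarrow> 0 < y j \<Longrightarrow> j \<in> upper X R a" by force
qed

lemma upper_antisym: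
  assumes "strict_linear_orderp_on X R" "a \<in> upper X R b" "b \<in> upper X R a"
  shows "a = b"
  using assms unfolding strict_linear_orderp_on_def upper_def irreflp_on_def transp_on_def by blast

text \<open>Carries a firm's order on sets to workers via singletons, and a worker's order on
  options to firms via \<open>Some\<close>.\<close>

lemma strict_linear_orderp_on_vimage:
  assumes "strict_linear_orderp_on Y R" "inj_on g X" "g ` X \<subseteq> Y"
  shows "strict_linear_orderp_on X (\<lambda>a b. R (g a) (g b))"
  unfolding strict_linear_orderp_on_def
proof (intro conjI)
  show "irreflp_on X (\<lambda>a b. R (g a) (g b))" "totalp_on X (\<lambda>a b. R (g a) (g b))"
    using assms unfolding strict_linear_orderp_on_def irreflp_on_def totalp_on_def inj_on_def by blast+
  show "transp_on X (\<lambda>a b. R (g a) (g b))"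
  proof (rule transp_onI)
    fix u v w assume "u \<in> X" "v \<in> X" "w \<in> X" "R (g u) (g v)" "R (g v) (g w)"
    then show "R (g u) (g w)"
      using assms unfolding strict_linear_orderp_on_def
      by (meson image_subset_iff transp_onD)
  qed
qed

section \<open>Vectors with entries in the unit interval and integral sum\<close>

lemma sum_unit_interval:
  fixes y :: "'a \<Rightarrow> real"
  assumes "finite X" "\<forall>j\<in>X. 0 \<le> y j \<and> y j \<le> 1"
  shows "sum y X = card {j \<in> X. y j = 1} + sum y {j \<in> X. 0 < y j \<and> y j < 1}"
proof -
  have "sum y X = (\<Sum>j\<in>X. (if y j = 1 then 1 else 0) + (if 0 < y j \<and> y j < 1 then y j else 0))"
    using assms by (intro sum.cong) auto
  also have "\<dots> = (\<Sum>j\<in>X. if y j = 1 then 1 else 0) + (\<Sum>j\<in>X. if 0 < y j \<and> y j < 1 then y j else 0)"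
    by (rule sum.distrib)
  also have "\<dots> = card {j \<in> X. y j = 1} + sum y {j \<in> X. 0 < y j \<and> y j < 1}"
    using assms(1) by (simp add: sum.If_cases Int_def)
  finally show ?thesis .
qed

text \<open>All other entries are 0 or 1, so an integral total would force an integer strictly
  between 0 and 1.\<close>

lemma one_fractional_sum_not_nat:
  fixes y :: "'a \<Rightarrow> real"
  assumes "finite X" "\<forall>j\<in>X. 0 \<le> y j \<and> y j \<le> 1" "{j \<in> X. 0 < y j \<and> y j < 1} = {a}"
  shows "sum y X \<noteq> real n"
proof
  assume "sum y X = real n"
  then have "real n = card {j \<in> X. y j = 1} + y a"
    using sum_unit_interval[OF assms(1,2)] assms(3) by simp
  then have "y a = real_of_int (int n - int (card {j \<in> X. y j = 1}))" by simp
  then obtain z :: int where "y a = z" by blast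
  moreover have "0 < y a" "y a < 1" using assms(3) by auto
  ultimately have "0 < z" "z < 1" by auto
  then show False by simp
qed

text \<open>The two fractional entries add up to an integer strictly between 0 and 2.\<close>

lemma two_fractional_sum_nat:
  fixes y :: "'a \<Rightarrow> real"
  assumes "finite X" "\<forall>j\<in>X. 0 \<le> y j \<and> y j \<le> 1" "{j \<in> X. 0 < y j \<and> y j < 1} = {a, b}"
    and "a \<noteq> b" "sum y X = real n"
  shows "y a + y b = 1" "Suc (card {j \<in> X. y j = 1}) = n"
proof -
  have eq: "real n = card {j \<in> X. y j = 1} + (y a + y b)"
    using sum_unit_interval[OF assms(1,2)] assms by simp
  then have "y a + y b = real_of_int (int n - int (card {j \<in> X. y j = 1}))" by simp
  then obtain z :: int where "y a + y b = z" by blast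
  moreover have "0 < y a" "y a < 1" "0 < y b" "y b < 1" using assms(3) by auto
  ultimately have "0 < real_of_int z" "real_of_int z < 2" by linarith+
  then have "z = 1" by simp
  then show *: "y a + y b = 1" using \<open>y a + y b = z\<close> by simp
  show "Suc (card {j \<in> X. y j = 1}) = n" using eq unfolding * by linarith
qed

section \<open>Counting in a bipartite graph\<close>

text \<open>\<open>E\<close> is the edge set of a bipartite graph. As \<open>E - A\<close> lies in
  \<open>B\<close> and \<open>E - B\<close> in \<open>A\<close>, injectivity and covering give a
  closed cycle of inequalities between cardinalities, so all of them are equalities.\<close>

lemma disjoint_perfect_matchings:
  assumes fin: "finite E" and E: "E = A \<union> B"
    and inj: "inj_on fst A" "inj_on snd B"
    and cov: "fst ` E \<subseteq> fst ` (E - A)" "snd ` E \<subseteq> snd ` (E - B)"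
  shows "A \<inter> B = {}" "inj_on snd A" "inj_on fst B"
    "fst ` A = fst ` E" "fst ` B = fst ` E" "snd ` A = snd ` E" "snd ` B = snd ` E"
proof -
  have injs: "inj_on snd (E - A)" "inj_on fst (E - B)"
    using inj E by (auto intro: inj_on_subset)
  have eqs: "fst ` (E - A) = fst ` E" "snd ` (E - B) = snd ` E" using cov by auto
  have "card (fst ` E) \<le> card (E - A)" using eqs fin by (metis card_image_le finite_Diff)
  moreover have "card (E - A) = card (snd ` (E - A))" using injs by (simp add: card_image)
  moreover have le1: "card (snd ` (E - A)) \<le> card (snd ` E)" using fin by (intro card_mono) auto
  moreover have "card (snd ` E) \<le> card (E - B)" using eqs fin by (metis card_image_le finite_Diff)
  moreover have "card (E - B) = card (fst ` (E - B))" using injs by (simp add: card_image)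
  moreover have le2: "card (fst ` (E - B)) \<le> card (fst ` E)" using fin by (intro card_mono) auto
  ultimately have cards: "card (fst ` E) = card (E - A)" "card (snd ` (E - A)) = card (snd ` E)"
    "card (snd ` E) = card (E - B)" "card (fst ` (E - B)) = card (fst ` E)" by linarith+
  have sndA: "snd ` (E - A) = snd ` E"
    using cards(2) fin by (intro card_subset_eq) auto
  have fstB: "fst ` (E - B) = fst ` E"
    using cards(4) fin by (intro card_subset_eq) auto
  show disj: "A \<inter> B = {}"
  proof (rule ccontr)
    assume "A \<inter> B \<noteq> {}"
    then obtain e where e: "e \<in> A" "e \<in> B" by auto
    \<comment> \<open>The edge \<open>e\<close> shares its second endpoint with an edge outside
      \<open>A\<close>. That edge lies in \<open>B\<close> together with \<open>e\<close>, against
      injectivity of \<open>snd\<close> on \<open>B\<close>.\<close>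
    then have "snd e \<in> snd ` (E - A)" using sndA E by auto
    then obtain e' where e': "e' \<in> E" "e' \<notin> A" "snd e' = snd e" by auto
    then have "e' = e" using E e inj(2) by (auto dest: inj_onD)
    with e e' show False by simp
  qed
  then have AB: "E - A = B" "E - B = A" using E by auto
  show "inj_on snd A" using cards(3) eqs(2) fin AB by (intro eq_card_imp_inj_on) auto
  show "inj_on fst B" using cards(1) eqs(1) fin AB by (intro eq_card_imp_inj_on) auto
  show "fst ` A = fst ` E" "fst ` B = fst ` E" "snd ` A = snd ` E" "snd ` B = snd ` E"
    using eqs sndA fstB AB by auto
qed

section \<open>Finite integration over thresholds\<close>

text \<open>The integral of the indicator of \<open>t \<le> v m\<close>, written over the cells of a
  partition: monotonicity cuts the sum off at \<open>l = m\<close> and the rest telescopes.\<close>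

lemma sum_telescope_threshold:
  fixes v :: "nat \<Rightarrow> real"
  assumes "\<And>i j. i < j \<Longrightarrow> j \<le> k \<Longrightarrow> v i < v j" "m \<le> k"
  shows "(\<Sum>l=1..k. (v l - v (l - 1)) * (if v l \<le> v m then 1 else 0)) = v m - v 0"
proof -
  have iff: "v l \<le> v m \<longleftrightarrow> l \<le> m" if "l \<le> k" for l
    using assms(1)[of l m] assms(1)[of m l] assms(2) that by (cases l m rule: linorder_cases) auto
  have "(\<Sum>l=1..k. (v l - v (l - 1)) * (if v l \<le> v m then 1 else 0)) =
        (\<Sum>l=1..k. if l \<in> {1..m} then v l - v (l - 1) else 0)"
    by (intro sum.cong) (auto simp: iff)
  also have "\<dots> = (\<Sum>l\<in>{1..k} \<inter> {1..m}. v l - v (l - 1))"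
    by (subst sum.inter_restrict) auto
  also have "{1..k} \<inter> {1..m} = {Suc 0..m}" using assms(2) by auto
  also have "(\<Sum>l=Suc 0..m. v l - v (l - 1)) = v m - v 0"
    by (induction m) auto
  finally show ?thesis .
qed

text \<open>Index 0 holds the extra value 0, which is outside \<open>V\<close>, so that even the
  least element of \<open>V\<close> closes a cell. The last value is 1 because 1 is the maximum of
  \<open>V\<close>.\<close>

lemma increasing_enumeration:
  fixes V :: "real set"
  assumes "finite V" "1 \<in> V" "\<forall>t\<in>V. 0 < t \<and> t \<le> 1"
  obtains k and v :: "nat \<Rightarrow> real"
  where "v 0 = 0" "v k = 1" "v ` {1..k} = V" "\<And>i j. i < j \<Longrightarrow> j \<le> k \<Longrightarrow> v i < v j"
proof -
  define vs where "vs = 0 # sorted_list_of_set V"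
  define k where "k = card V"
  have set: "set vs = insert 0 V" and len: "length vs = Suc k"
    using assms(1) by (auto simp: vs_def k_def)
  have sorted: "sorted_wrt (<) vs"
    using assms by (auto simp: vs_def)
  have mono: "vs ! i < vs ! j" if "i < j" "j \<le> k" for i j
    using sorted_wrt_nth_less[OF sorted, of i j] that len by auto
  have img: "(!) vs ` {1..k} = V"
  proof -
    have "{1..k} = Suc ` {0..<k}" by (auto simp: image_Suc_atLeastLessThan)
    then have "(!) vs ` {1..k} = (!) (sorted_list_of_set V) ` {0..<k}"
      by (simp add: image_image vs_def del: image_Suc_atLeastLessThan)
    also have "\<dots> = set (sorted_list_of_set V)"
      using assms(1) by (simp add: k_def set_conv_nth image_def Bex_def) metis
    finally show ?thesis using assms(1) by simp
  qed
  have "vs ! k = 1"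
  proof -
    obtain i where i: "i \<in> {1..k}" "vs ! i = 1" using img assms(2) by (metis imageE)
    have "vs ! k \<in> V" using i img by (metis atLeastAtMost_iff dual_order.trans imageI order_refl)
    then have "\<not> vs ! i < vs ! k" using i assms(3) by auto
    then show ?thesis using i mono[of i k] by (cases "i = k") auto
  qed
  then show thesis using that[of "(!) vs" k] mono img by (simp add: vs_def)
qed

section \<open>Fractional pairs of a strongly stable point\<close>

locale strongly_stable =
  fixes M :: "('f, 'w) market" and x :: "'f \<Rightarrow> 'w \<Rightarrow> real"
  assumes market: "responsive_market M"
    and strongly: "strongly_stable_fractional M x"
begin

definition firm_upper :: "'f \<Rightarrow> 'w \<Rightarrow> 'w set" where
  "firm_upper f = upper (workers M) (\<lambda>j k. fpref M f {j} {k})"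

definition worker_upper :: "'w \<Rightarrow> 'f \<Rightarrow> 'f set" where
  "worker_upper w = upper (firms M) (\<lambda>i k. wpref M w (Some i) (Some k))"

definition fractional :: "('f \<times> 'w) set" where
  "fractional = {(f, w). f \<in> firms M \<and> w \<in> workers M \<and> 0 < x f w \<and> x f w < 1}"

definition firm_last :: "('f \<times> 'w) set" where
  "firm_last = {(f, w) \<in> fractional. sum (x f) (firm_upper f w) = quota M f}"

definition worker_last :: "('f \<times> 'w) set" where
  "worker_last = {(f, w) \<in> fractional. (\<Sum>i\<in>worker_upper w f. x i w) = 1}"

lemma fin [simp]: "finite (firms M)" "finite (workers M)"
  using market by (auto simp: responsive_market_def)

lemma in_CP: "x \<in> CP M"
  using strongly by (simp add: strongly_stable_fractional_def)

lemma nonneg: "f \<in> firms M \<Longrightarrow> w \<in> workers M \<Longrightarrow> 0 \<le> x f w"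
  using in_CP by (auto simp: CP_def)

lemma firm_sum_le: "f \<in> firms M \<Longrightarrow> sum (x f) (workers M) \<le> quota M f"
  using in_CP by (auto simp: CP_def)

lemma worker_sum_le: "w \<in> workers M \<Longrightarrow> (\<Sum>i\<in>firms M. x i w) \<le> 1"
  using in_CP by (auto simp: CP_def)

lemma le_one:
  assumes "f \<in> firms M" "w \<in> workers M"
  shows "x f w \<le> 1"
proof -
  have "x f w \<le> (\<Sum>i\<in>firms M. x i w)"
    using assms nonneg by (intro member_le_sum) auto
  then show ?thesis using worker_sum_le[OF assms(2)] by simp
qed

lemma unit_interval:
  shows "f \<in> firms M \<Longrightarrow> \<forall>w\<in>workers M. 0 \<le> x f w \<and> x f w \<le> 1"
    and "w \<in> workers M \<Longrightarrow> \<forall>f\<in>firms M. 0 \<le> x f w \<and> x f w \<le> 1"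
  using nonneg le_one by auto

lemma support_acceptable:
  "f \<in> firms M \<Longrightarrow> w \<in> workers M \<Longrightarrow> 0 < x f w \<Longrightarrow> (f, w) \<in> acceptable M"
  using in_CP by (force simp: CP_def)

lemma acceptable_cases:
  assumes "(f, w) \<in> acceptable M"
  shows "sum (x f) (firm_upper f w) = quota M f \<or> (\<Sum>i\<in>worker_upper w f. x i w) = 1"
proof -
  have "{j. j \<in> workers M \<and> (fpref M f)\<^sup>=\<^sup>= {j} {w}} = firm_upper f w"
    by (auto simp: firm_upper_def upper_def)
  moreover have "{i. i \<in> firms M \<and> (wpref M w)\<^sup>=\<^sup>= (Some i) (Some f)} = worker_upper w f"
    by (auto simp: worker_upper_def upper_def)
  ultimately show ?thesis
    using strongly assms by (fastforce simp: strongly_stable_fractional_def)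
qed

lemma firm_order:
  "f \<in> firms M \<Longrightarrow> strict_linear_orderp_on (workers M) (\<lambda>j k. fpref M f {j} {k})"
  using market
  by (intro strict_linear_orderp_on_vimage[where Y = "Pow (workers M)"
        and R = "fpref M f" and g = "\<lambda>j. {j}"])
    (auto simp: responsive_market_def)

lemma worker_order:
  "w \<in> workers M \<Longrightarrow> strict_linear_orderp_on (firms M) (\<lambda>i k. wpref M w (Some i) (Some k))"
  using market
  by (intro strict_linear_orderp_on_vimage[where Y = "insert None (Some ` firms M)"
        and R = "wpref M w" and g = Some])
    (auto simp: responsive_market_def)

lemma firm_upper_full:
  assumes "f \<in> firms M" "sum (x f) (firm_upper f w) = quota M f"
  shows "sum (x f) (workers M) = quota M f"
    and "j \<in> workers M \<Longrightarrow> 0 < x f j \<Longrightarrow> j \<in> firm_upper f w"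
proof -
  note full = upper_sum_full[OF fin(2) _ firm_sum_le[OF assms(1)] assms(2)[unfolded firm_upper_def]]
  show "sum (x f) (workers M) = quota M f"
    by (rule full(1)) (use assms(1) nonneg in blast)
  show "j \<in> firm_upper f w" if "j \<in> workers M" "0 < x f j"
    unfolding firm_upper_def by (rule full(2)) (use that assms(1) nonneg in blast)+
qed

lemma worker_upper_full:
  assumes "w \<in> workers M" "(\<Sum>i\<in>worker_upper w f. x i w) = 1"
  shows "(\<Sum>i\<in>firms M. x i w) = 1"
    and "i \<in> firms M \<Longrightarrow> 0 < x i w \<Longrightarrow> i \<in> worker_upper w f"
proof -
  note full = upper_sum_full[OF fin(1) _ worker_sum_le[OF assms(1)] assms(2)[unfolded worker_upper_def]]
  show "(\<Sum>i\<in>firms M. x i w) = 1"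
    by (rule full(1)) (use assms(1) nonneg in blast)
  show "i \<in> worker_upper w f" if "i \<in> firms M" "0 < x i w"
    unfolding worker_upper_def by (rule full(2)) (use that assms(1) nonneg in blast)+
qed

text \<open>Positive weight makes a fractional pair acceptable, so one of the two factors in strong
  stability vanishes at it.\<close>

lemma frac_split: "fractional = firm_last \<union> worker_last"
  using acceptable_cases support_acceptable
  by (fastforce simp: fractional_def firm_last_def worker_last_def)

text \<open>Two such workers of one firm both carry positive weight, so each lies in the upper set
  of the other; antisymmetry identifies them.\<close>

lemma inj_firm_last: "inj_on fst firm_last"
proof (rule inj_onI)
  fix p p' assume "p \<in> firm_last" "p' \<in> firm_last" "fst p = fst p'"
  moreover obtain f w f' w' where "p = (f, w)" "p' = (f', w')" by (metis surj_pair)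
  ultimately show "p = p'"
    using firm_upper_full(2) upper_antisym[OF firm_order]
    by (auto simp: firm_last_def fractional_def firm_upper_def)
qed

lemma inj_worker_last: "inj_on snd worker_last"
proof (rule inj_onI)
  fix p p' assume "p \<in> worker_last" "p' \<in> worker_last" "snd p = snd p'"
  moreover obtain f w f' w' where "p = (f, w)" "p' = (f', w')" by (metis surj_pair)
  ultimately show "p = p'"
    using worker_upper_full(2) upper_antisym[OF worker_order]
    by (auto simp: worker_last_def fractional_def worker_upper_def)
qed

section \<open>Counting fractional firms and workers\<close>

text \<open>Otherwise all fractional pairs of some \<open>f\<close> are in \<open>firm_last\<close>,
  so by injectivity there is only one. But then \<open>f\<close> is full, and its integral quota
  would be a sum with a single fractional entry.\<close>

lemma firm_cover: "fst ` fractional \<subseteq> fst ` (fractional - firm_last)"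
proof (rule ccontr)
  assume "\<not> fst ` fractional \<subseteq> fst ` (fractional - firm_last)"
  then obtain f w where fw: "(f, w) \<in> fractional" "f \<notin> fst ` (fractional - firm_last)" by fastforce
  then have all: "(f, w') \<in> firm_last" if "(f, w') \<in> fractional" for w'
    using that by (metis DiffI fst_conv imageI)
  then have "(f, j) \<in> fractional \<longleftrightarrow> j = w" for j
    using fw(1) inj_onD[OF inj_firm_last, of "(f, j)" "(f, w)"] by (metis fst_conv snd_conv)
  moreover have "{j \<in> workers M. 0 < x f j \<and> x f j < 1} = {j. (f, j) \<in> fractional}"
    using fw(1) by (auto simp: fractional_def)
  ultimately have "{j \<in> workers M. 0 < x f j \<and> x f j < 1} = {w}" by auto
  moreover have f: "f \<in> firms M" using fw(1) by (simp add: fractional_def)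
  moreover have "sum (x f) (workers M) = quota M f"
    using firm_upper_full(1) f all[OF fw(1)] by (auto simp: firm_last_def)
  ultimately show False
    using one_fractional_sum_not_nat[OF fin(2) unit_interval(1)[OF f]] by blast
qed

lemma worker_cover: "snd ` fractional \<subseteq> snd ` (fractional - worker_last)"
proof (rule ccontr)
  assume "\<not> snd ` fractional \<subseteq> snd ` (fractional - worker_last)"
  then obtain f w where fw: "(f, w) \<in> fractional" "w \<notin> snd ` (fractional - worker_last)" by fastforce
  then have all: "(f', w) \<in> worker_last" if "(f', w) \<in> fractional" for f'
    using that by (metis DiffI snd_conv imageI)
  then have "(i, w) \<in> fractional \<longleftrightarrow> i = f" for i
    using fw(1) inj_onD[OF inj_worker_last, of "(i, w)" "(f, w)"] by (metis fst_conv snd_conv)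
  moreover have "{i \<in> firms M. 0 < x i w \<and> x i w < 1} = {i. (i, w) \<in> fractional}"
    using fw(1) by (auto simp: fractional_def)
  ultimately have "{i \<in> firms M. 0 < x i w \<and> x i w < 1} = {f}" by auto
  moreover have w: "w \<in> workers M" using fw(1) by (simp add: fractional_def)
  moreover have "(\<Sum>i\<in>firms M. x i w) = real 1"
    using worker_upper_full(1) w all[OF fw(1)] by (auto simp: worker_last_def)
  ultimately show False
    using one_fractional_sum_not_nat[OF fin(1) unit_interval(2)[OF w]] by blast
qed

lemma finite_frac: "finite fractional"
  by (rule finite_subset[of _ "firms M \<times> workers M"]) (auto simp: fractional_def)

text \<open>Here \<open>A\<close> is \<open>firm_last\<close> and \<open>B\<close> is
  \<open>worker_last\<close>: (1) is disjointness, (2) and (3) are injectivity in the remaining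
  coordinates, (4) to (7) cover all fractional firms and workers.\<close>

lemmas last_matchings =
  disjoint_perfect_matchings[OF finite_frac frac_split inj_firm_last inj_worker_last
    firm_cover worker_cover]

lemma worker_last_unique:
  "(f, w) \<in> worker_last \<Longrightarrow> (f, w') \<in> worker_last \<Longrightarrow> w = w'"
  "(f, w) \<in> worker_last \<Longrightarrow> (f', w) \<in> worker_last \<Longrightarrow> f = f'"
  using inj_onD[OF inj_worker_last, of "(f, w)" "(f', w)"]
    inj_onD[OF last_matchings(3), of "(f, w)" "(f, w')"] by simp_all

lemma firm_last_unique:
  "(f, w) \<in> firm_last \<Longrightarrow> (f, w') \<in> firm_last \<Longrightarrow> w = w'"
  "(f, w) \<in> firm_last \<Longrightarrow> (f', w) \<in> firm_last \<Longrightarrow> f = f'"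
  using inj_onD[OF inj_firm_last, of "(f, w)" "(f, w')"]
    inj_onD[OF last_matchings(2), of "(f, w)" "(f', w)"] by simp_all

text \<open>The two perfect matchings supply one partner each, \<open>b\<close> and
  \<open>c\<close>. These share a single seat, the others being held by workers of weight 1, and
  \<open>b\<close> is preferred because \<open>c\<close> is last in the support.\<close>

lemma firm_structure:
  assumes "(f, w) \<in> fractional"
  obtains b c where "(f, b) \<in> worker_last" "(f, c) \<in> firm_last"
    "{j \<in> workers M. 0 < x f j \<and> x f j < 1} = {b, c}"
    "x f b + x f c = 1" "Suc (card {j \<in> workers M. x f j = 1}) = quota M f"
    "fpref M f {b} {c}"
proof -
  have f: "f \<in> firms M" using assms by (simp add: fractional_def)
  have "f \<in> fst ` worker_last" "f \<in> fst ` firm_last"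
    using assms last_matchings(4,5) by force+
  then obtain b c where bc: "(f, b) \<in> worker_last" "(f, c) \<in> firm_last" by auto
  then have ne: "b \<noteq> c" using last_matchings(1) by auto
  have "(f, j) \<in> fractional \<longleftrightarrow> j = b \<or> j = c" for j
    using bc frac_split worker_last_unique(1) firm_last_unique(1) by blast
  then have set: "{j \<in> workers M. 0 < x f j \<and> x f j < 1} = {b, c}"
    using f by (auto simp: fractional_def)
  have full: "sum (x f) (firm_upper f c) = quota M f" using bc by (simp add: firm_last_def)
  have "fpref M f {b} {c}"
    using firm_upper_full(2)[OF f full, of b] set ne by (auto simp: firm_upper_def upper_def)
  moreover note two_fractional_sum_nat[OF fin(2) unit_interval(1)[OF f] set ne firm_upper_full(1)[OF f full]]
  ultimately show thesis using that bc set by blast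
qed

text \<open>Dual to \<open>firm_structure\<close>, with total 1: the shared unit uses the whole
  capacity of \<open>w\<close>, which excludes any pair of weight 1.\<close>

lemma worker_structure:
  assumes "(f, w) \<in> fractional"
  obtains b c where "(b, w) \<in> worker_last" "(c, w) \<in> firm_last" "x b w + x c w = 1"
    "\<And>i. i \<in> firms M \<Longrightarrow> x i w \<noteq> 1"
proof -
  have w: "w \<in> workers M" using assms by (simp add: fractional_def)
  have "w \<in> snd ` worker_last" "w \<in> snd ` firm_last"
    using assms last_matchings(6,7) by force+
  then obtain b c where bc: "(b, w) \<in> worker_last" "(c, w) \<in> firm_last" by auto
  then have ne: "b \<noteq> c" using last_matchings(1) by auto
  have "(i, w) \<in> fractional \<longleftrightarrow> i = b \<or> i = c" for i
    using bc frac_split worker_last_unique(2) firm_last_unique(2) by blast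
  then have set: "{i \<in> firms M. 0 < x i w \<and> x i w < 1} = {b, c}"
    using w by (auto simp: fractional_def)
  have full: "(\<Sum>i\<in>firms M. x i w) = real 1"
    using bc worker_upper_full(1)[OF w, of b] by (simp add: worker_last_def)
  note two = two_fractional_sum_nat[OF fin(1) unit_interval(2)[OF w] set ne full]
  have "{i \<in> firms M. x i w = 1} = {}" using two(2) by simp
  then show thesis using that bc two(1) by auto
qed

section \<open>Rounding at a threshold\<close>

text \<open>The weak and the strict inequality are complementary: if
  \<open>x f b + x f c = 1\<close>, then \<open>1 - x f c < t\<close> means
  \<open>x f b < t\<close>. So each fractional firm, and likewise each fractional worker, keeps
  exactly one of its two fractional pairs, for any real \<open>t\<close>.\<close>

definition rounded :: "real \<Rightarrow> ('f \<times> 'w) set" where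
  "rounded t = {(f, w). f \<in> firms M \<and> w \<in> workers M \<and>
     (x f w = 1 \<or> (f, w) \<in> worker_last \<and> t \<le> x f w \<or> (f, w) \<in> firm_last \<and> 1 - x f w < t)}"

definition \<mu> :: "real \<Rightarrow> 'w \<Rightarrow> 'f option" where
  "\<mu> t w = (if \<exists>f. (f, w) \<in> rounded t then Some (SOME f. (f, w) \<in> rounded t) else None)"

lemma rounded_pos: "(f, w) \<in> rounded t \<Longrightarrow> 0 < x f w"
  by (auto simp: rounded_def worker_last_def firm_last_def fractional_def)

text \<open>A fractional worker has complementary conditions on its two firms; any other worker
  matched twice would have two pairs of weight 1, above its capacity.\<close>

lemma rounded_unique:
  assumes "(f, w) \<in> rounded t" "(f', w) \<in> rounded t"
  shows "f = f'"
proof (cases "\<exists>i. (i, w) \<in> fractional")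
  case True
  then obtain b c where bc: "(b, w) \<in> worker_last" "(c, w) \<in> firm_last" "x b w + x c w = 1"
    "\<And>i. i \<in> firms M \<Longrightarrow> x i w \<noteq> 1"
    by (meson worker_structure)
  have "i = b \<and> t \<le> x b w \<or> i = c \<and> 1 - x c w < t" if "(i, w) \<in> rounded t" for i
    using that bc(4) worker_last_unique(2)[OF bc(1)] firm_last_unique(2)[OF bc(2)]
    by (fastforce simp: rounded_def)
  from this[OF assms(1)] this[OF assms(2)] bc(3) show ?thesis by auto
next
  case False
  then have one: "x f w = 1" "x f' w = 1" and mem: "f \<in> firms M" "f' \<in> firms M" "w \<in> workers M"
    using assms frac_split by (auto simp: rounded_def)
  show ?thesis
  proof (rule ccontr)
    assume "f \<noteq> f'"
    then have "(\<Sum>i\<in>{f, f'}. x i w) = 2" using one by simp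
    moreover have "(\<Sum>i\<in>{f, f'}. x i w) \<le> (\<Sum>i\<in>firms M. x i w)"
      using mem nonneg by (intro sum_mono2) auto
    ultimately show False using worker_sum_le[OF mem(3)] by simp
  qed
qed

lemma \<mu>_iff: "\<mu> t w = Some f \<longleftrightarrow> (f, w) \<in> rounded t"
proof
  show "(f, w) \<in> rounded t" if "\<mu> t w = Some f"
    using that someI_ex[of "\<lambda>f. (f, w) \<in> rounded t"] by (auto simp: \<mu>_def split: if_splits)
  show "\<mu> t w = Some f" if "(f, w) \<in> rounded t"
    using that rounded_unique[OF that someI[of "\<lambda>f. (f, w) \<in> rounded t", OF that]]
    by (auto simp: \<mu>_def)
qed

lemma assigned_\<mu>: "assigned M (\<mu> t) f = {w. (f, w) \<in> rounded t}"
  by (auto simp: assigned_def \<mu>_iff rounded_def)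

lemma assigned_nonfrac:
  assumes "f \<in> firms M" "\<And>w. (f, w) \<notin> fractional"
  shows "assigned M (\<mu> t) f = {j \<in> workers M. x f j = 1}"
    and "card (assigned M (\<mu> t) f) = sum (x f) (workers M)"
proof -
  show eq: "assigned M (\<mu> t) f = {j \<in> workers M. x f j = 1}"
    using assms frac_split by (auto simp: assigned_\<mu> rounded_def)
  have "{j \<in> workers M. 0 < x f j \<and> x f j < 1} = {}" using assms by (auto simp: fractional_def)
  then show "card (assigned M (\<mu> t) f) = sum (x f) (workers M)"
    using sum_unit_interval[OF fin(2) unit_interval(1)[OF assms(1)]]
    unfolding eq by (simp del: Collect_empty_eq)
qed

text \<open>The set of a fractional firm changes at the single threshold \<open>x f b\<close>,
  beyond which \<open>c\<close> replaces \<open>b\<close>.\<close>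

lemma assigned_frac:
  assumes "(f, b) \<in> worker_last" "(f, c) \<in> firm_last" "x f b + x f c = 1"
  shows "assigned M (\<mu> t) f = {j \<in> workers M. x f j = 1} \<union> {if t \<le> x f b then b else c}"
proof -
  have "f \<in> firms M" "b \<in> workers M" "c \<in> workers M"
    using assms by (auto simp: worker_last_def firm_last_def fractional_def)
  moreover have "(f, j) \<in> worker_last \<longleftrightarrow> j = b" "(f, j) \<in> firm_last \<longleftrightarrow> j = c" for j
    using assms worker_last_unique(1) firm_last_unique(1) by blast+
  ultimately show ?thesis
    using assms(3) by (auto simp: assigned_\<mu> rounded_def)
qed

text \<open>A fractional firm fills its one shared seat at every \<open>t\<close>; for any other
  firm the head count equals the sum of its weights.\<close>

lemma card_assigned:
  assumes f: "f \<in> firms M"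
  shows "card (assigned M (\<mu> t) f) \<le> quota M f"
    and "sum (x f) (workers M) = quota M f \<Longrightarrow> card (assigned M (\<mu> t) f) = quota M f"
proof -
  have "card (assigned M (\<mu> t) f) \<le> quota M f \<and>
    (sum (x f) (workers M) = quota M f \<longrightarrow> card (assigned M (\<mu> t) f) = quota M f)"
  proof (cases "\<exists>w. (f, w) \<in> fractional")
    case True
    then obtain w where "(f, w) \<in> fractional" by blast
    then obtain b c where bc: "(f, b) \<in> worker_last" "(f, c) \<in> firm_last" "x f b + x f c = 1"
      "Suc (card {j \<in> workers M. x f j = 1}) = quota M f"
      by (rule firm_structure) blast
    define d where "d = (if t \<le> x f b then b else c)"
    have "x f d < 1"
      using bc(1,2) by (auto simp: d_def worker_last_def firm_last_def fractional_def)
    then have "card ({j \<in> workers M. x f j = 1} \<union> {d}) = quota M f"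
      using bc(4) by (subst card_Un_disjoint) auto
    then show ?thesis using assigned_frac[OF bc(1-3), of t] by (simp add: d_def)
  next
    case False
    then show ?thesis using assigned_nonfrac(2)[OF f, of t] firm_sum_le[OF f] by auto
  qed
  then show "card (assigned M (\<mu> t) f) \<le> quota M f"
    "sum (x f) (workers M) = quota M f \<Longrightarrow> card (assigned M (\<mu> t) f) = quota M f" by auto
qed

text \<open>For a fractional worker one of the two complementary conditions holds; otherwise some
  nonzero weight is 1 and survives at every threshold.\<close>

lemma full_worker_assigned:
  assumes "w \<in> workers M" "(\<Sum>i\<in>firms M. x i w) = 1"
  shows "\<exists>f. \<mu> t w = Some f"
proof (cases "\<exists>i. (i, w) \<in> fractional")
  case True
  then obtain b c where "(b, w) \<in> worker_last" "(c, w) \<in> firm_last" "x b w + x c w = 1"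
    by (meson worker_structure)
  moreover from this have "b \<in> firms M" "c \<in> firms M"
    by (auto simp: worker_last_def firm_last_def fractional_def)
  ultimately have "(if t \<le> x b w then b else c, w) \<in> rounded t"
    using assms(1) by (auto simp: rounded_def)
  then show ?thesis using \<mu>_iff by blast
next
  case False
  have "\<exists>i\<in>firms M. x i w \<noteq> 0" using assms(2) by (metis sum.neutral zero_neq_one)
  then obtain i where i: "i \<in> firms M" "x i w \<noteq> 0" by auto
  then have "x i w = 1"
    using False assms(1) nonneg[of i w] le_one[of i w] by (force simp: fractional_def)
  then have "(i, w) \<in> rounded t" using i assms(1) by (simp add: rounded_def)
  then show ?thesis using \<mu>_iff by blast
qed

section \<open>Stability of the rounded matchings\<close>

text \<open>A blocking pair is acceptable, so strong stability makes one side full at it. A full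
  firm has all its assigned workers in the support, hence none worse than \<open>w\<close>; a full
  worker is assigned a firm no worse than \<open>f\<close>.\<close>

lemma \<mu>_stable: "stable_matching M (\<mu> t)"
proof -
  have codomain: "\<mu> t w \<in> insert None (Some ` firms M)" for w
    by (cases "\<mu> t w") (auto simp: \<mu>_iff rounded_def)
  have ir: "individually_rational M (\<mu> t)"
    by (auto simp: individually_rational_def \<mu>_iff intro: support_acceptable rounded_pos)
  have "\<not> blocks M f w (\<mu> t)" if f: "f \<in> firms M" and w: "w \<in> workers M" for f w
  proof
    assume bl: "blocks M f w (\<mu> t)"
    have word: "irreflp_on (insert None (Some ` firms M)) (wpref M w)"
      "transp_on (insert None (Some ` firms M)) (wpref M w)"
      and ford: "transp_on (Pow (workers M)) (fpref M f)" "irreflp_on (Pow (workers M)) (fpref M f)"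
      using market f w by (auto simp: responsive_market_def strict_linear_orderp_on_def)
    have pref: "wpref M w (Some f) (\<mu> t w)" using bl by (simp add: blocks_def)
    \<comment> \<open>Blocking compares \<open>f\<close> only with the current partner of
      \<open>w\<close>; individual rationality and transitivity extend this to being
      unmatched.\<close>
    have "wpref M w (Some f) None"
    proof (cases "\<mu> t w")
      case (Some i)
      then have i: "i \<in> firms M" "wpref M w (Some i) None"
        using ir w codomain[of w] by (auto simp: individually_rational_def acceptable_def)
      then show ?thesis using pref Some f transp_onD[OF word(2), of "Some f" "Some i" None] by auto
    qed (use pref in simp)
    moreover have "fpref M f {w} {}"
    proof -
      have "fpref M f {w} {}" if j: "j \<in> assigned M (\<mu> t) f" "fpref M f {w} {j}" for j
      proof -
        have "j \<in> workers M" "fpref M f {j} {}"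
          using j(1) ir f by (auto simp: individually_rational_def acceptable_def assigned_def)
        then show ?thesis using j(2) w transp_onD[OF ford(1), of "{w}" "{j}" "{}"] by auto
      qed
      then show ?thesis using bl by (auto simp: blocks_def)
    qed
    ultimately have "(f, w) \<in> acceptable M" using f w by (simp add: acceptable_def)
    then consider "sum (x f) (firm_upper f w) = quota M f" | "(\<Sum>i\<in>worker_upper w f. x i w) = 1"
      using acceptable_cases by blast
    then show False
    proof cases
      case 1
      then have "card (assigned M (\<mu> t) f) = quota M f"
        using firm_upper_full(1)[OF f] card_assigned(2)[OF f] by simp
      \<comment> \<open>Fullness rules out a vacancy, so the block must displace some
        \<open>j\<close> worse than \<open>w\<close>.\<close>
      then obtain j where j: "j \<in> assigned M (\<mu> t) f" "fpref M f {w} {j}"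
        using bl by (auto simp: blocks_def)
      then have "j \<in> firm_upper f w"
        using firm_upper_full(2)[OF f 1] rounded_pos by (auto simp: assigned_\<mu> rounded_def)
      moreover from this j(2) w have "w \<in> firm_upper f j" by (auto simp: firm_upper_def upper_def)
      ultimately have "w = j"
        using upper_antisym[OF firm_order[OF f]] by (simp add: firm_upper_def)
      then show False using j(2) w ford(2) by (auto simp: irreflp_on_def)
    next
      case 2
      then obtain i where i: "\<mu> t w = Some i"
        using worker_upper_full(1)[OF w] full_worker_assigned[OF w] by blast
      then have "i \<in> worker_upper w f"
        using worker_upper_full(2)[OF w 2] rounded_pos by (auto simp: \<mu>_iff rounded_def)
      moreover have "f \<in> worker_upper w i"
        using pref i f by (auto simp: worker_upper_def upper_def)
      ultimately have "i = f"
        using upper_antisym[OF worker_order[OF w]] by (simp add: worker_upper_def)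
      then show False using bl i by (simp add: blocks_def)
    qed
  qed
  then show ?thesis
    using ir codomain card_assigned(1) by (auto simp: stable_matching_def matching_def)
qed

section \<open>Monotonicity for the firms\<close>

text \<open>Between \<open>s\<close> and \<open>t\<close> a firm either keeps its set or replaces
  \<open>b\<close> by the less preferred \<open>c\<close>; responsiveness lifts the comparison of
  the two workers to the sets.\<close>

lemma firm_prefers:
  assumes "f \<in> firms M" "s \<le> t"
  shows "(fpref M f)\<^sup>=\<^sup>= (assigned M (\<mu> s) f) (assigned M (\<mu> t) f)"
    and "(f, b) \<in> worker_last \<Longrightarrow> s \<le> x f b \<Longrightarrow> x f b < t \<Longrightarrow>
      fpref M f (assigned M (\<mu> s) f) (assigned M (\<mu> t) f)"
proof -
  have strict: "(f, b) \<in> worker_last \<and> s \<le> x f b \<and> x f b < t \<longrightarrow>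
      fpref M f (assigned M (\<mu> s) f) (assigned M (\<mu> t) f)" for b
  proof
    assume b: "(f, b) \<in> worker_last \<and> s \<le> x f b \<and> x f b < t"
    then have "(f, b) \<in> fractional" by (simp add: worker_last_def)
    then obtain b' c where bc: "(f, b') \<in> worker_last" "(f, c) \<in> firm_last" "x f b' + x f c = 1"
      "Suc (card {j \<in> workers M. x f j = 1}) = quota M f" "fpref M f {b'} {c}"
      by (rule firm_structure)
    have [simp]: "b' = b" using bc(1) b worker_last_unique(1) by blast
    have mem: "x f b < 1" "x f c < 1" "b \<in> workers M" "c \<in> workers M"
      using bc by (auto simp: worker_last_def firm_last_def fractional_def)
    have "responsive (workers M) (quota M f) (fpref M f)"
      using market assms(1) by (auto simp: responsive_market_def)
    then have "\<forall>T w w'. T \<subseteq> workers M \<and> card T < quota M f \<and> w \<in> workers M - T \<and> w' \<in> workers M - T \<longrightarrow>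
        (fpref M f (T \<union> {w}) (T \<union> {w'}) \<longleftrightarrow> fpref M f {w} {w'})"
      unfolding responsive_def by blast
    \<comment> \<open>\<open>T\<close> is the set of workers of weight 1. Its size is one below the
      quota, so the strict size bound in responsiveness holds.\<close>
    from this[rule_format, of "{j \<in> workers M. x f j = 1}" b c]
    have "fpref M f ({j \<in> workers M. x f j = 1} \<union> {b}) ({j \<in> workers M. x f j = 1} \<union> {c})"
      using mem bc(4,5) by auto
    then show "fpref M f (assigned M (\<mu> s) f) (assigned M (\<mu> t) f)"
      using assigned_frac[OF bc(1-3)] b by auto
  qed
  then show "(f, b) \<in> worker_last \<Longrightarrow> s \<le> x f b \<Longrightarrow> x f b < t \<Longrightarrow>
      fpref M f (assigned M (\<mu> s) f) (assigned M (\<mu> t) f)" by blast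
  show "(fpref M f)\<^sup>=\<^sup>= (assigned M (\<mu> s) f) (assigned M (\<mu> t) f)"
  proof (cases "\<exists>w. (f, w) \<in> fractional")
    case True
    then obtain b c where bc: "(f, b) \<in> worker_last" "(f, c) \<in> firm_last" "x f b + x f c = 1"
      by (meson firm_structure)
    then show ?thesis
      \<comment> \<open>The sets differ only if \<open>s \<le> x f b < t\<close>; the reverse
        change, from \<open>c\<close> back to \<open>b\<close>, is excluded by
        \<open>s \<le> t\<close>.\<close>
      using strict[of b] assms(2) assigned_frac[OF bc, of s] assigned_frac[OF bc, of t]
      by (cases "s \<le> x f b"; cases "t \<le> x f b") auto
  next
    case False
    then show ?thesis using assigned_nonfrac(1)[OF assms(1)] by auto
  qed
qed

section \<open>Decomposition along a chain\<close>

lemma chain_decomposition: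
  "\<exists>(k::nat) (\<mu> :: nat \<Rightarrow> 'w \<Rightarrow> 'f option) (\<alpha> :: nat \<Rightarrow> real).
    (\<forall>l\<in>{1..k}. stable_matching M (\<mu> l)) \<and>
    (\<forall>f\<in>firms M. \<forall>w\<in>workers M. x f w = (\<Sum>l=1..k. \<alpha> l * incidence (\<mu> l) f w)) \<and>
    (\<forall>l\<in>{1..k}. 0 < \<alpha> l \<and> \<alpha> l \<le> 1) \<and>
    (\<Sum>l=1..k. \<alpha> l) = 1 \<and>
    (\<forall>l\<in>{1..<k}. firms_prefer M (\<mu> l) (\<mu> (l + 1)))"
proof -
  \<comment> \<open>The thresholds at which some firm changes its set, with 1 as the right end of
    the interval. A pair in \<open>firm_last\<close> switches at \<open>1 - x f c = x f b\<close>,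
    which is among them.\<close>
  define V where "V = insert 1 ((\<lambda>(f, w). x f w) ` worker_last)"
  have "finite worker_last" using finite_frac frac_split by auto
  then have "finite V" "1 \<in> V" "\<forall>t\<in>V. 0 < t \<and> t \<le> 1"
    by (auto simp: V_def worker_last_def fractional_def)
  then obtain v :: "nat \<Rightarrow> real" and k where v: "v 0 = 0" "v k = 1" "v ` {1..k} = V"
    and mono: "\<And>i j. i < j \<Longrightarrow> j \<le> k \<Longrightarrow> v i < v j"
    by (rule increasing_enumeration) blast
  \<comment> \<open>The length of the cell \<open>(v (l - 1), v l]\<close>, on which
    \<open>\<mu> t\<close> is constant; its right end serves as the representative.\<close>
  define \<alpha> where "\<alpha> l = v l - v (l - 1)" for l
  have le1: "v l \<le> 1" if "l \<le> k" for l
    using mono[of l k] that v(2) by (cases "l = k") auto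
  have ge0: "0 \<le> v l" if "l \<le> k" for l
    using mono[of 0 l] that v(1) by (cases "l = 0") auto
  have threshold: "(\<Sum>l=1..k. \<alpha> l * (if v l \<le> c then 1 else 0)) = c" if "c \<in> V" for c
  proof -
    obtain m where "m \<le> k" "c = v m" using v(3) \<open>c \<in> V\<close> by auto
    then show ?thesis using sum_telescope_threshold[of k v m] mono v(1) by (simp add: \<alpha>_def)
  qed
  have total: "sum \<alpha> {1..k} = 1"
  proof -
    have "sum \<alpha> {1..k} = (\<Sum>l=1..k. \<alpha> l * (if v l \<le> 1 then 1 else 0))"
      using le1 by (intro sum.cong) auto
    then show ?thesis using threshold[OF \<open>1 \<in> V\<close>] by simp
  qed
  have \<alpha>: "0 < \<alpha> l \<and> \<alpha> l \<le> 1" if "l \<in> {1..k}" for l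
  proof -
    have "l - 1 < l" "l \<le> k" "l - 1 \<le> k" using that by auto
    then show ?thesis
      using mono[of "l - 1" l] le1[of l] ge0[of "l - 1"] unfolding \<alpha>_def by linarith
  qed
  have decomp: "x f w = (\<Sum>l=1..k. \<alpha> l * incidence (\<mu> (v l)) f w)"
    if f: "f \<in> firms M" and w: "w \<in> workers M" for f w
  proof -
    have "x f w = 0 \<or> x f w = 1 \<or> (f, w) \<in> fractional"
      using nonneg[OF f w] le_one[OF f w] f w by (auto simp: fractional_def)
    then consider "x f w = 0" | "x f w = 1" | "(f, w) \<in> worker_last" | "(f, w) \<in> firm_last"
      using frac_split by blast
    then show ?thesis
    proof cases
      case 1
      then have "incidence (\<mu> t) f w = 0" for t
        using rounded_pos[of f w t] by (auto simp: incidence_def \<mu>_iff)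
      then show ?thesis using 1 by simp
    next
      case 2
      then have "incidence (\<mu> t) f w = 1" for t
        using f w by (auto simp: incidence_def \<mu>_iff rounded_def)
      then show ?thesis using 2 total by simp
    next
      case 3
      then have "(f, w) \<notin> firm_last" "x f w < 1" "x f w \<in> V"
        using last_matchings(1) by (auto simp: worker_last_def fractional_def V_def)
      then have "incidence (\<mu> t) f w = (if t \<le> x f w then 1 else 0)" for t
        using f w 3 by (auto simp: incidence_def \<mu>_iff rounded_def)
      then show ?thesis using threshold[OF \<open>x f w \<in> V\<close>] by simp
    next
      case 4
      then have "(f, w) \<in> fractional" by (simp add: firm_last_def)
      then obtain b c where bc: "(f, b) \<in> worker_last" "(f, c) \<in> firm_last" "x f b + x f c = 1"
        by (meson firm_structure)
      then have "c = w" using 4 firm_last_unique(1) by blast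
      then have eq: "x f w = 1 - x f b" and V: "x f b \<in> V" using bc by (force simp: V_def)+
      have "(f, w) \<notin> worker_last" "x f w < 1"
        using 4 last_matchings(1) by (auto simp: firm_last_def fractional_def)
      \<comment> \<open>This pair is chosen exactly when \<open>(f, b)\<close> is not, so its sum is
        the total minus the one with threshold \<open>x f b\<close>.\<close>
      then have "incidence (\<mu> t) f w = 1 - (if t \<le> x f b then 1 else 0)" for t
        using f w 4 eq by (auto simp: incidence_def \<mu>_iff rounded_def)
      then have "(\<Sum>l=1..k. \<alpha> l * incidence (\<mu> (v l)) f w) =
          sum \<alpha> {1..k} - (\<Sum>l=1..k. \<alpha> l * (if v l \<le> x f b then 1 else 0))"
        by (simp add: right_diff_distrib sum_subtractf)
      then show ?thesis using threshold[OF V] total eq by simp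
    qed
  qed
  have chain: "firms_prefer M (\<mu> (v l)) (\<mu> (v (l + 1)))" if l: "l \<in> {1..<k}" for l
  proof -
    have less: "v l < v (l + 1)" using mono[of l "l + 1"] l by simp
    \<comment> \<open>A member of \<open>V\<close> below 1 is the weight of a pair in
      \<open>worker_last\<close>; the firm of that pair makes its swap between \<open>v l\<close>
      and \<open>v (l + 1)\<close>, which gives the strict preference.\<close>
    then have "v l < 1" using le1[of "l + 1"] l by simp
    moreover have "v l \<in> V" using v(3) l by (metis atLeastAtMost_iff atLeastLessThan_iff imageI less_imp_le)
    ultimately obtain f b where fb: "(f, b) \<in> worker_last" "v l = x f b" by (auto simp: V_def)
    then have "f \<in> firms M" by (simp add: worker_last_def fractional_def)
    moreover from this have "fpref M f (assigned M (\<mu> (v l)) f) (assigned M (\<mu> (v (l + 1))) f)"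
      using fb less by (intro firm_prefers(2)) auto
    ultimately show ?thesis
      using firm_prefers(1) less unfolding firms_prefer_def by (meson less_imp_le)
  qed
  show ?thesis
    using \<mu>_stable decomp \<alpha> total chain
    by (intro exI[of _ k] exI[of _ "\<lambda>l. \<mu> (v l)"] exI[of _ \<alpha>]) simp
qed

end

theorem theorem1:
  fixes M :: "('f, 'w) market" and x :: "'f \<Rightarrow> 'w \<Rightarrow> real"
  assumes "responsive_market M"
    and "strongly_stable_fractional M x"
  shows "\<exists>(k::nat) (\<mu> :: nat \<Rightarrow> 'w \<Rightarrow> 'f option) (\<alpha> :: nat \<Rightarrow> real).
    (\<forall>l\<in>{1..k}. stable_matching M (\<mu> l)) \<and>
    (\<forall>f\<in>firms M. \<forall>w\<in>workers M. x f w = (\<Sum>l=1..k. \<alpha> l * incidence (\<mu> l) f w)) \<and>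
    (\<forall>l\<in>{1..k}. 0 < \<alpha> l \<and> \<alpha> l \<le> 1) \<and>
    (\<Sum>l=1..k. \<alpha> l) = 1 \<and>
    (\<forall>l\<in>{1..<k}. firms_prefer M (\<mu> l) (\<mu> (l + 1)))"
  by (rule strongly_stable.chain_decomposition) (use assms in \<open>unfold_locales\<close>)

end
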